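(* The palindromic width of $$\mathbb{Z} \wr \mathbb{Z} \ = \ \left\langle \, a, t \, \left| \, \left[a,a^{t^k}\right]=1 \ (k \in \mathbb{Z}) \, \right. \right\rangle$$ with respect to the generating set $\{a,t\}$ is exactly $3$; that is, $\mathrm{PW}(\mathbb{Z}\wr\mathbb{Z},\{a,t\})=3$.
   Context: For a group $H$ with generating set $X$, a palindromic word on $X \cup X^{-1}$ is a finite word with letters in $X\cup X^{-1}$ (not necessarily reduced) that reads the same forwards as backwards. The palindromic width $\mathrm{PW}(H,X)$ is the minimal $n$ such that every $h\in H$ can be expressed as a product of $n$ or fewer elements represented by palindromic words on $X\cup X^{-1}$ (and is infinite if no such $n$ exists). Here $a^{t^k}$ denotes the conjugate of $a$ by $t^k$. Equivalently, $\mathbb{Z}\wr\mathbb{Z} = \left(\bigoplus_{\mathbb{Z}}\mathbb{Z}\right)\rtimes \mathbb{Z}$, with $\bigoplus_{\mathbb{Z}}\mathbb{Z}$ the group of finitely supported functions $\mathbb{Z}\to\mathbb{Z}$ on which $\mathbb{Z}$ acts by shifts; $a=(\Delta_1,0)$, where $\Delta_1$ is $1$ at $0$ and $0$ elsewhere, and $t=(\mathbf{0},1)$, where $\mathbf{0}$ is the zero function. *)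

theory Defs
  imports "HOL-Algebra.Free_Abelian_Groups" "HOL-Library.Extended_Nat"
begin

section \<open>Palindromic width\<close>

text \<open>Letters are the elements of \<open>X \<union> X\<^sup>-\<^sup>1\<close> themselves. Words need not be reduced, and the empty
  word counts as a palindrome.\<close>

definition palindromic_word :: "('g, 'm) monoid_scheme \<Rightarrow> 'g set \<Rightarrow> 'g list \<Rightarrow> bool" where
  "palindromic_word H X w \<longleftrightarrow> set w \<subseteq> X \<union> (\<lambda>x. inv\<^bsub>H\<^esub> x) ` X \<and> rev w = w"

definition palindromes :: "('g, 'm) monoid_scheme \<Rightarrow> 'g set \<Rightarrow> 'g set" where
  "palindromes H X = {foldr (\<otimes>\<^bsub>H\<^esub>) w \<one>\<^bsub>H\<^esub> | w. palindromic_word H X w}"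

text \<open>The infimum in \<^typ>\<open>enat\<close> is the minimum if the set is nonempty, and is \<open>\<infinity>\<close> if it is empty.\<close>

definition palindromic_width :: "('g, 'm) monoid_scheme \<Rightarrow> 'g set \<Rightarrow> enat" where
  "palindromic_width H X =
     Inf {enat n | n. \<forall>h \<in> carrier H. \<exists>ps. length ps \<le> n \<and> set ps \<subseteq> palindromes H X \<and>
                                          h = foldr (\<otimes>\<^bsub>H\<^esub>) ps \<one>\<^bsub>H\<^esub>}"


section \<open>The wreath product of the integers with the integers\<close>

text \<open>The type \<^typ>\<open>int \<Rightarrow>\<^sub>0 int\<close> consists of the finitely supported functions, that is, it is the
  direct sum of copies of the integers indexed by the integers. Translation is injective, so
  \<open>map_key\<close> is here precomposition; see \<open>lookup_shift\<close>.\<close>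

definition shift :: "int \<Rightarrow> (int \<Rightarrow>\<^sub>0 int) \<Rightarrow> (int \<Rightarrow>\<^sub>0 int)" where
  "shift m f = Poly_Mapping.map_key (\<lambda>i. i - m) f"

definition ZwrZ :: "((int \<Rightarrow>\<^sub>0 int) \<times> int) monoid" where
  "ZwrZ = \<lparr>carrier = UNIV, monoid.mult = (\<lambda>(f, m) (g, n). (f + shift m g, m + n)), one = (0, 0)\<rparr>"

definition wr_a :: "(int \<Rightarrow>\<^sub>0 int) \<times> int" where
  "wr_a = (Poly_Mapping.single 0 1, 0)"

definition wr_t :: "(int \<Rightarrow>\<^sub>0 int) \<times> int" where
  "wr_t = (0, 1)"

lemma inj_minus_int [simp]: "inj (\<lambda>i. i - m :: int)"
  by (simp add: inj_def)

lemma lookup_shift: "Poly_Mapping.lookup (shift m f) i = Poly_Mapping.lookup f (i - m)"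
  by (simp add: shift_def map_key.rep_eq)

lemma shift_simps [simp]:
  "shift m 0 = 0" "shift 0 f = f" "shift m (f + g) = shift m f + shift m g"
  "shift m (f - g) = shift m f - shift m g" "shift m (- f) = - shift m f"
  "shift m (shift n f) = shift (m + n) f"
  "shift m (Poly_Mapping.single k c) = Poly_Mapping.single (k + m) c"
  by (rule poly_mapping_eqI; auto simp: lookup_shift lookup_add lookup_minus algebra_simps
        lookup_single when_def)+

lemma shift_one [simp]: "shift m 1 = Poly_Mapping.single m 1"
  using shift_simps(7)[of m 0 1] by simp

lemma ZwrZ_simps [simp]:
  "carrier ZwrZ = UNIV" "\<one>\<^bsub>ZwrZ\<^esub> = (0, 0)"
  "(f, m) \<otimes>\<^bsub>ZwrZ\<^esub> (g, n) = (f + shift m g, m + n)"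
  by (simp_all add: ZwrZ_def)

lemma group_ZwrZ: "group ZwrZ"
proof (rule groupI)
  fix x assume "x \<in> carrier ZwrZ"
  obtain f m where "x = (f, m)" by fastforce
  then show "\<exists>y \<in> carrier ZwrZ. y \<otimes>\<^bsub>ZwrZ\<^esub> x = \<one>\<^bsub>ZwrZ\<^esub>"
    by (intro bexI[of _ "(- shift (- m) f, - m)"]) auto
qed (auto simp: add.assoc split_paired_all)

interpretation ZwrZ: group ZwrZ
  by (rule group_ZwrZ)

lemma inv_ZwrZ: "inv\<^bsub>ZwrZ\<^esub> (f, m) = (- shift (- m) f, - m)"
  by (rule ZwrZ.inv_equality) auto

lemma nat_pow_wr_t: "wr_t [^]\<^bsub>ZwrZ\<^esub> (n :: nat) = (0, int n)"
  by (induction n) (auto simp: wr_t_def)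

lemma int_pow_wr_t: "wr_t [^]\<^bsub>ZwrZ\<^esub> (k :: int) = (0, k)"
  by (simp add: int_pow_def2 nat_pow_wr_t inv_ZwrZ)

lemma conj_wr_a:
  "inv\<^bsub>ZwrZ\<^esub> (wr_t [^]\<^bsub>ZwrZ\<^esub> (k :: int)) \<otimes>\<^bsub>ZwrZ\<^esub> wr_a \<otimes>\<^bsub>ZwrZ\<^esub> wr_t [^]\<^bsub>ZwrZ\<^esub> k
     = (Poly_Mapping.single (- k) 1, 0)"
  by (simp add: int_pow_wr_t inv_ZwrZ wr_a_def)

lemma generate_ZwrZ: "generate ZwrZ {wr_a, wr_t} = carrier ZwrZ"
proof -
  let ?S = "generate ZwrZ {wr_a, wr_t}"
  have sub: "subgroup ?S ZwrZ"
    by (rule ZwrZ.generate_is_subgroup) simp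
  have t: "(0, k) \<in> ?S" for k
    using ZwrZ.subgroup_int_pow_closed[OF sub, of wr_t k]
    by (simp add: int_pow_wr_t generate.incl)
  have e: "(Poly_Mapping.single k 1, 0) \<in> ?S" for k
  proof -
    have "(0, k) \<otimes>\<^bsub>ZwrZ\<^esub> wr_a \<otimes>\<^bsub>ZwrZ\<^esub> (0, - k) \<in> ?S"
      by (intro subgroup.m_closed[OF sub] t generate.incl) simp
    then show ?thesis by (simp add: wr_a_def)
  qed
  have f: "(f, 0) \<in> ?S" for f
    using subset_UNIV[of "Poly_Mapping.keys f"]
  proof (induction f rule: frag_induction)
    case (diff f g)
    then have "(f, 0) \<otimes>\<^bsub>ZwrZ\<^esub> inv\<^bsub>ZwrZ\<^esub> (g, 0) \<in> ?S"
      by (intro subgroup.m_closed[OF sub] subgroup.m_inv_closed[OF sub])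
    then show ?case by (simp add: inv_ZwrZ)
  qed (use t e in auto)
  have "(f, m) \<in> ?S" for f m
    using subgroup.m_closed[OF sub f t, of f m] by simp
  then show ?thesis by auto
qed


section \<open>The presentation\<close>

definition commutator :: "('g, 'm) monoid_scheme \<Rightarrow> 'g \<Rightarrow> 'g \<Rightarrow> 'g" where
  "commutator G x y = inv\<^bsub>G\<^esub> x \<otimes>\<^bsub>G\<^esub> inv\<^bsub>G\<^esub> y \<otimes>\<^bsub>G\<^esub> x \<otimes>\<^bsub>G\<^esub> y"

definition conjugate :: "('g, 'm) monoid_scheme \<Rightarrow> 'g \<Rightarrow> 'g \<Rightarrow> 'g" where
  "conjugate G x y = inv\<^bsub>G\<^esub> y \<otimes>\<^bsub>G\<^esub> x \<otimes>\<^bsub>G\<^esub> y"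

lemma (in group) commutator_eq_one_iff:
  assumes "x \<in> carrier G" "y \<in> carrier G"
  shows "commutator G x y = \<one> \<longleftrightarrow> x \<otimes> y = y \<otimes> x"
proof -
  have "commutator G x y = inv (y \<otimes> x) \<otimes> (x \<otimes> y)"
    using assms by (simp add: commutator_def inv_mult_group m_assoc)
  then show ?thesis
    using assms inv_solve_left'[of "\<one>" "y \<otimes> x" "x \<otimes> y"] by auto
qed

lemma ZwrZ_relations:
  "commutator ZwrZ wr_a (conjugate ZwrZ wr_a (wr_t [^]\<^bsub>ZwrZ\<^esub> (k :: int))) = \<one>\<^bsub>ZwrZ\<^esub>"
  unfolding conjugate_def conj_wr_a
  by (subst ZwrZ.commutator_eq_one_iff) (simp_all add: wr_a_def add.commute)

lemma (in group) comm_group_generate: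
  assumes S: "S \<subseteq> carrier G" and comm: "\<And>x y. x \<in> S \<Longrightarrow> y \<in> S \<Longrightarrow> x \<otimes> y = y \<otimes> x"
  shows "comm_group (G\<lparr>carrier := generate G S\<rparr>)"
proof -
  define C where "C T = {x \<in> carrier G. \<forall>y \<in> T. x \<otimes> y = y \<otimes> x}" for T
  have sub: "subgroup (C T) G" if "T \<subseteq> carrier G" for T
  proof (rule subgroupI)
    fix x assume x: "x \<in> C T"
    have "inv x \<otimes> y = y \<otimes> inv x" if "y \<in> T" for y
    proof -
      have y: "y \<in> carrier G" and eq: "x \<otimes> y = y \<otimes> x" and xc: "x \<in> carrier G"
        using that x \<open>T \<subseteq> carrier G\<close> by (auto simp: C_def)
      have "inv x \<otimes> y = inv x \<otimes> (y \<otimes> x) \<otimes> inv x"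
        using y xc by (simp add: m_assoc)
      also have "\<dots> = y \<otimes> inv x"
        using y xc by (simp flip: eq m_assoc)
      finally show ?thesis .
    qed
    then show "inv x \<in> C T" using x by (auto simp: C_def)
  next
    fix x y assume xy: "x \<in> C T" "y \<in> C T"
    have "x \<otimes> y \<otimes> z = z \<otimes> (x \<otimes> y)" if "z \<in> T" for z
    proof -
      have c: "x \<in> carrier G" "y \<in> carrier G" "z \<in> carrier G"
        using xy that \<open>T \<subseteq> carrier G\<close> by (auto simp: C_def)
      have "x \<otimes> y \<otimes> z = x \<otimes> (z \<otimes> y)"
        using xy that c by (simp add: C_def m_assoc)
      also have "\<dots> = x \<otimes> z \<otimes> y"
        using c by (simp add: m_assoc)
      also have "\<dots> = z \<otimes> x \<otimes> y"
        using xy that by (simp add: C_def)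
      also have "\<dots> = z \<otimes> (x \<otimes> y)"
        using c by (simp add: m_assoc)
      finally show ?thesis .
    qed
    then show "x \<otimes> y \<in> C T" using xy by (auto simp: C_def)
  next
    have "\<one> \<in> C T" using that by (auto simp: C_def)
    then show "C T \<noteq> {}" by blast
  qed (auto simp: C_def)
  have gen: "generate G S \<subseteq> carrier G"
    using generate_incl[OF S] .
  have "S \<subseteq> C S" using S comm by (auto simp: C_def)
  then have "generate G S \<subseteq> C S"
    by (rule generate_subgroup_incl) (rule sub[OF S])
  then have "S \<subseteq> C (generate G S)"
    using S by (fastforce simp: C_def)
  then have "generate G S \<subseteq> C (generate G S)"
    by (rule generate_subgroup_incl) (rule sub[OF gen])
  then show ?thesis
    by (intro group.group_comm_groupI subgroup_imp_group generate_is_subgroup S)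
       (auto simp: C_def)
qed

text \<open>Together with \<open>generate_ZwrZ\<close> and \<open>ZwrZ_relations\<close>, the following universal property says that
  \<^const>\<open>ZwrZ\<close> is the group with generators \<open>a, t\<close> and relators \<open>[a, a^(t^k)]\<close> for all integers \<open>k\<close>.\<close>

lemma ZwrZ_universal:
  fixes H (structure)
  assumes "group H" and b: "b \<in> carrier H" and s: "s \<in> carrier H"
    and rel: "\<And>k :: int. commutator H b (conjugate H b (s [^] k)) = \<one>"
  shows "\<exists>\<phi> \<in> hom ZwrZ H. \<phi> wr_a = b \<and> \<phi> wr_t = s"
proof -
  interpret H: group H by fact
  define c where "c k = s [^] k \<otimes> b \<otimes> s [^] (- k)" for k :: int
  have c_carr [simp]: "c k \<in> carrier H" for k
    using b s by (simp add: c_def)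
  have c_conj: "s [^] m \<otimes> c k \<otimes> s [^] (- m) = c (k + m)" for k m
  proof -
    have "s [^] m \<otimes> c k \<otimes> s [^] (- m) = (s [^] m \<otimes> s [^] k) \<otimes> b \<otimes> (s [^] (- k) \<otimes> s [^] (- m))"
      using b s by (simp add: c_def H.m_assoc)
    then show ?thesis
      using s by (simp add: c_def add.commute flip: H.int_pow_mult)
  qed
  have conj_mult: "s [^] m \<otimes> (x \<otimes> y) \<otimes> s [^] (- m)
      = (s [^] m \<otimes> x \<otimes> s [^] (- m)) \<otimes> (s [^] m \<otimes> y \<otimes> s [^] (- m))"
    if "x \<in> carrier H" "y \<in> carrier H" for x y and m :: int
  proof -
    have "s [^] (- m) \<otimes> (s [^] m \<otimes> z) = z" if "z \<in> carrier H" for z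
      using that s by (simp add: H.int_pow_neg flip: H.m_assoc)
    then show ?thesis using that s by (simp add: H.m_assoc)
  qed
  have c0: "c 0 = b" using b by (simp add: c_def)
  have comm0: "c 0 \<otimes> c k = c k \<otimes> c 0" for k
  proof -
    have "conjugate H b (s [^] (- k)) = c k"
      using s b by (simp add: conjugate_def c_def H.int_pow_neg)
    then show ?thesis
      using rel[of "- k"] b c_carr[of k] by (simp add: H.commutator_eq_one_iff c0)
  qed
  have comm: "c j \<otimes> c k = c k \<otimes> c j" for j k
    using arg_cong[OF comm0[of "k - j"], of "\<lambda>x. s [^] j \<otimes> x \<otimes> s [^] (- j)"]
    by (simp add: conj_mult c_conj)
  define K where "K = H\<lparr>carrier := generate H (range c)\<rparr>"
  have "comm_group K"
    unfolding K_def by (rule H.comm_group_generate) (auto simp: comm)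
  then interpret K: comm_group K .
  have "c ` UNIV \<subseteq> carrier K"
    by (auto simp: K_def generate.incl)
  then obtain h where h: "h \<in> hom (free_Abelian_group UNIV) K" "\<And>k. h (frag_of k) = c k"
    using K.free_Abelian_group_universal[of c UNIV] by auto
  have h_carr [simp]: "h f \<in> carrier H" for f
    using hom_in_carrier[OF h(1), of f] H.generate_in_carrier[of "range c" "h f"]
    by (simp add: K_def image_subset_iff)
  have h_add: "h (f + g) = h f \<otimes> h g" for f g
    using hom_mult[OF h(1), of f g] by (simp add: K_def)
  have h_0: "h 0 = \<one>"
    using h_add[of 0 0] by (simp add: H.l_cancel_one')
  have h_shift: "h (shift m f) = s [^] m \<otimes> h f \<otimes> s [^] (- m)" for m f
    using subset_UNIV[of "Poly_Mapping.keys f"]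
  proof (induction f rule: frag_induction)
    case zero
    show ?case using s by (simp add: h_0 H.int_pow_neg)
  next
    case (one k)
    then show ?case by (simp add: h(2) c_conj)
  next
    case (diff f g)
    let ?q = "\<lambda>x. s [^] m \<otimes> x \<otimes> s [^] (- m)"
    have "h (shift m (f - g)) \<otimes> h (shift m g) = h (shift m f)"
      by (simp flip: h_add)
    also have "\<dots> = ?q (h (f - g) \<otimes> h g)"
      by (simp add: diff flip: h_add)
    also have "\<dots> = ?q (h (f - g)) \<otimes> h (shift m g)"
      by (simp add: conj_mult diff)
    finally show ?case using s by simp
  qed
  define \<phi> where "\<phi> = (\<lambda>(f, m). h f \<otimes> s [^] (m :: int))"
  have "\<phi> \<in> hom ZwrZ H"
  proof (rule homI)
    fix x y :: "(int \<Rightarrow>\<^sub>0 int) \<times> int"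
    obtain f m g n where xy: "x = (f, m)" "y = (g, n)" by fastforce
    have "\<phi> (x \<otimes>\<^bsub>ZwrZ\<^esub> y) = h f \<otimes> s [^] m \<otimes> h g \<otimes> (s [^] (- m) \<otimes> s [^] (m + n))"
      using s by (simp add: xy \<phi>_def h_add h_shift H.m_assoc)
    also have "s [^] (- m) \<otimes> s [^] (m + n) = s [^] n"
      using s by (simp flip: H.int_pow_mult)
    finally show "\<phi> (x \<otimes>\<^bsub>ZwrZ\<^esub> y) = \<phi> x \<otimes> \<phi> y"
      using s by (simp add: xy \<phi>_def H.m_assoc)
  qed (use s in \<open>auto simp: \<phi>_def\<close>)
  moreover have "\<phi> wr_a = b"
    using b h(2)[of 0] by (simp add: \<phi>_def wr_a_def c0)
  moreover have "\<phi> wr_t = s"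
    using s by (simp add: \<phi>_def wr_t_def h_0)
  ultimately show ?thesis by blast
qed

end

theory Submission
  imports Defs
begin

text \<open>Reversal of words induces the involutive anti-automorphism \<open>(f, m) \<mapsto> (i \<mapsto> f (m - i), m)\<close>, whose
  fixed points are exactly the palindromes: \<open>(f, m)\<close> is one iff \<open>f\<close> is symmetric about \<open>m/2\<close>.

  Upper bound: the reflections \<open>i \<mapsto> -i\<close> and \<open>i \<mapsto> 1 - i\<close> compose to translation by one, so modulo sums of
  functions symmetric under one of them all point masses agree up to sign and vanish, since the point
  mass at \<open>0\<close> is itself symmetric. Hence every \<open>(f, 1)\<close> is a product of two palindromes, and
  \<open>(f, m) = (f, 1) t^(m - 1)\<close>.

  Lower bound: if \<open>(f, 0)\<close> is a product of two palindromes, both are symmetric about the same point,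
  hence so is \<open>f\<close>; but the function with values \<open>1, 2\<close> at \<open>0, 1\<close> has no symmetry.\<close>

text \<open>Indexing by the sum \<open>m\<close> of a point and its mirror image keeps the centre
  \<open>m/2\<close>, possibly a half-integer, within integer arithmetic.\<close>

definition reflect :: "int \<Rightarrow> (int \<Rightarrow>\<^sub>0 int) \<Rightarrow> (int \<Rightarrow>\<^sub>0 int)" where
  "reflect m f = Poly_Mapping.map_key (\<lambda>i. m - i) f"

lemma lookup_reflect: "Poly_Mapping.lookup (reflect m f) i = Poly_Mapping.lookup f (m - i)"
  by (simp add: reflect_def map_key.rep_eq inj_def)

lemma reflect_simps [simp]:
  "reflect m 0 = 0" "reflect m (f + g) = reflect m f + reflect m g"
  "reflect m (f - g) = reflect m f - reflect m g"
  "reflect m (shift n f) = reflect (m - n) f" "shift n (reflect m f) = reflect (m + n) f"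
  "reflect m (reflect n f) = shift (m - n) f"
  "reflect m (Poly_Mapping.single k c) = Poly_Mapping.single (m - k) c"
  by (rule poly_mapping_eqI; auto simp: lookup_reflect lookup_shift lookup_add lookup_minus
        algebra_simps lookup_single when_def)+

lemma reflect_uminus [simp]: "reflect m (- f) = - reflect m f"
  using reflect_simps(3)[of m 0 f] by simp

lemma reflect_one [simp]: "reflect m 1 = Poly_Mapping.single m 1"
  using reflect_simps(7)[of m 0 1] by simp

definition reversal :: "(int \<Rightarrow>\<^sub>0 int) \<times> int \<Rightarrow> (int \<Rightarrow>\<^sub>0 int) \<times> int" where
  "reversal = (\<lambda>(f, m). (reflect m f, m))"

lemma reversal_mult: "reversal (x \<otimes>\<^bsub>ZwrZ\<^esub> y) = reversal y \<otimes>\<^bsub>ZwrZ\<^esub> reversal x"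
  by (cases x; cases y) (simp add: reversal_def add.commute)

abbreviation letters :: "((int \<Rightarrow>\<^sub>0 int) \<times> int) set" where
  "letters \<equiv> {wr_a, wr_t} \<union> (\<lambda>x. inv\<^bsub>ZwrZ\<^esub> x) ` {wr_a, wr_t}"

abbreviation word_value :: "((int \<Rightarrow>\<^sub>0 int) \<times> int) list \<Rightarrow> (int \<Rightarrow>\<^sub>0 int) \<times> int" where
  "word_value w \<equiv> foldr (\<otimes>\<^bsub>ZwrZ\<^esub>) w \<one>\<^bsub>ZwrZ\<^esub>"

text \<open>The letters from \<open>a\<close> are supported at \<open>0\<close> and have second
  component \<open>0\<close>; those from \<open>t\<close> carry the zero function.\<close>

lemma reversal_letter: "x \<in> letters \<Longrightarrow> reversal x = x"
  by (auto simp: reversal_def wr_a_def wr_t_def inv_ZwrZ)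

lemma word_value_append: "word_value (v @ w) = word_value v \<otimes>\<^bsub>ZwrZ\<^esub> word_value w"
  by (induction v) (auto simp: ZwrZ.m_assoc simp del: ZwrZ_simps(2,3) intro: ZwrZ.l_one[symmetric])

lemma word_value_rev: "set w \<subseteq> letters \<Longrightarrow> word_value (rev w) = reversal (word_value w)"
proof (induction w)
  case Nil
  then show ?case by (simp add: reversal_def)
next
  case (Cons x w)
  have "word_value (rev (x # w)) = word_value (rev w) \<otimes>\<^bsub>ZwrZ\<^esub> word_value [x]"
    by (simp only: rev.simps word_value_append)
  also have "word_value [x] = x"
    by (cases x) simp
  finally show ?case
    using Cons by (simp add: reversal_mult reversal_letter del: ZwrZ_simps(2,3))
qed

lemma exists_word: "\<exists>w. set w \<subseteq> letters \<and> word_value w = x"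
proof -
  have "x \<in> generate ZwrZ {wr_a, wr_t}"
    by (simp add: generate_ZwrZ)
  then show ?thesis
  proof induction
    case one
    show ?case by (intro exI[of _ "[]"]) simp
  next
    case (incl h)
    then show ?case by (intro exI[of _ "[h]"]) (cases h; auto)
  next
    case (inv h)
    then show ?case by (intro exI[of _ "[inv\<^bsub>ZwrZ\<^esub> h]"]) (cases "inv\<^bsub>ZwrZ\<^esub> h"; auto)
  next
    case (eng x y)
    then obtain v w where "set v \<subseteq> letters" "word_value v = x" "set w \<subseteq> letters" "word_value w = y"
      by blast
    then show ?case
      by (intro exI[of _ "v @ w"]) (simp only: word_value_append set_append Un_least simp_thms)
  qed
qed

text \<open>If \<open>w\<close> spells \<open>x\<close>, then \<open>w @ c @ rev w\<close> is a
  palindrome spelling this product. This is how symmetric functions get realised by words.\<close>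

lemma mult_reversal_in_palindromes:
  assumes "set c \<subseteq> letters" "rev c = c"
  shows "x \<otimes>\<^bsub>ZwrZ\<^esub> word_value c \<otimes>\<^bsub>ZwrZ\<^esub> reversal x \<in> palindromes ZwrZ {wr_a, wr_t}"
proof -
  obtain w where w: "set w \<subseteq> letters" "word_value w = x"
    using exists_word by blast
  have "word_value (w @ c @ rev w) = x \<otimes>\<^bsub>ZwrZ\<^esub> word_value c \<otimes>\<^bsub>ZwrZ\<^esub> reversal x"
    using w by (simp only: word_value_append word_value_rev) (simp add: ZwrZ.m_assoc)
  moreover have "palindromic_word ZwrZ {wr_a, wr_t} (w @ c @ rev w)"
    using w assms unfolding palindromic_word_def by (simp only: set_append set_rev Un_least) simp
  ultimately show ?thesis
    unfolding palindromes_def by (intro CollectI exI conjI) (erule sym, assumption)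
qed

lemma in_palindromes_iff: "(f, m) \<in> palindromes ZwrZ {wr_a, wr_t} \<longleftrightarrow> reflect m f = f"
proof
  assume "(f, m) \<in> palindromes ZwrZ {wr_a, wr_t}"
  then obtain w where w: "set w \<subseteq> letters" "rev w = w" "word_value w = (f, m)"
    unfolding palindromes_def palindromic_word_def by auto
  then show "reflect m f = f"
    using word_value_rev[of w] by (simp add: reversal_def)
next
  assume sym: "reflect m f = f"
  have f: "Poly_Mapping.lookup f (m - i) = Poly_Mapping.lookup f i" for i
    using lookup_reflect[of m f i] by (simp add: sym)
  define k where "k = m div 2"
  \<comment> \<open>\<open>u\<close> is the part of \<open>f\<close> left of the centre
    \<open>m/2\<close>, together with half of the central value, rounded down.\<close>
  define u where "u = Poly_Mapping.mapp
    (\<lambda>i c. if 2 * i < m then c else if 2 * i = m then c div 2 else 0) f"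
  have u: "Poly_Mapping.lookup u i = (if 2 * i < m then Poly_Mapping.lookup f i
      else if 2 * i = m then Poly_Mapping.lookup f i div 2 else 0)" for i
    by (auto simp: u_def lookup_mapp when_def not_in_keys_iff_lookup_eq_zero)
  show "(f, m) \<in> palindromes ZwrZ {wr_a, wr_t}"
  proof (cases "even m")
    case True
    then have m: "m = 2 * k" by (simp add: k_def)
    \<comment> \<open>The central value is twice its rounded half plus \<open>e\<close>, so the
      middle word \<open>c\<close> must supply one \<open>a\<close> exactly when
      \<open>e = 1\<close>.\<close>
    define e where "e = Poly_Mapping.lookup f k mod 2"
    define c where "c = (if e = 0 then [] else [wr_a])"
    have "e = 0 \<or> e = 1" by (auto simp: e_def)
    then have c: "word_value c = (Poly_Mapping.single 0 e, 0)"
      by (auto simp: c_def wr_a_def)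
    have "f = u + Poly_Mapping.single k e + reflect m u"
    proof (rule poly_mapping_eqI)
      fix i
      show "Poly_Mapping.lookup f i
          = Poly_Mapping.lookup (u + Poly_Mapping.single k e + reflect m u) i"
        using f[of i]
        by (cases i k rule: linorder_cases)
          (simp_all add: lookup_add lookup_reflect u lookup_single when_def m e_def)
    qed
    then have "(f, m) = (u, k) \<otimes>\<^bsub>ZwrZ\<^esub> word_value c \<otimes>\<^bsub>ZwrZ\<^esub> reversal (u, k)"
      unfolding c by (simp add: reversal_def m)
    then show ?thesis
      using mult_reversal_in_palindromes[of c "(u, k)"] by (simp add: c_def)
  next
    case False
    then have m: "m = 2 * k + 1" by (simp add: k_def)
    have "f = u + reflect m u"
    proof (rule poly_mapping_eqI)
      fix i
      have "2 * i \<noteq> m" "2 * (m - i) \<noteq> m"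
        using m by presburger+
      then show "Poly_Mapping.lookup f i = Poly_Mapping.lookup (u + reflect m u) i"
        using f[of i] by (cases "i \<le> k") (simp_all add: lookup_add lookup_reflect u m)
    qed
    \<comment> \<open>No integer lies at the centre, so no central value remains; the middle letter
      \<open>t\<close> makes up the odd exponent \<open>2 * k + 1\<close>.\<close>
    then have "(f, m) = (u, k) \<otimes>\<^bsub>ZwrZ\<^esub> word_value [wr_t] \<otimes>\<^bsub>ZwrZ\<^esub> reversal (u, k)"
      by (simp add: wr_t_def reversal_def m)
    then show ?thesis
      using mult_reversal_in_palindromes[of "[wr_t]" "(u, k)"] by simp
  qed
qed

lemma symmetric_decomposition: "\<exists>g h. f = g + h \<and> reflect 0 g = g \<and> reflect 1 h = h"
proof -
  \<comment> \<open>\<open>S\<close> is closed under differences, so \<open>frag_induction\<close>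
    reduces the claim to point masses.\<close>
  define S where "S = {g + h | g h. reflect 0 g = g \<and> reflect 1 h = h}"
  have diff: "f - g \<in> S" if f: "f \<in> S" and g: "g \<in> S" for f g
  proof -
    obtain f1 f2 g1 g2 where "f = f1 + f2" "g = g1 + g2" "reflect 0 f1 = f1" "reflect 1 f2 = f2"
      "reflect 0 g1 = g1" "reflect 1 g2 = g2"
      using f g unfolding S_def by blast
    then have "f - g = (f1 - g1) + (f2 - g2)" "reflect 0 (f1 - g1) = f1 - g1"
      "reflect 1 (f2 - g2) = f2 - g2"
      by simp_all
    then show ?thesis unfolding S_def by blast
  qed
  have sym0: "g \<in> S" if "reflect 0 g = g" for g
    unfolding S_def by (rule CollectI, rule exI[of _ g], rule exI[of _ 0]) (simp add: that)
  have sym1: "h \<in> S" if "reflect 1 h = h" for h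
    unfolding S_def by (rule CollectI, rule exI[of _ 0], rule exI[of _ h]) (simp add: that)
  have neg: "frag_of (- k) \<in> S" if "frag_of k \<in> S" for k
    using diff[OF sym0[of "frag_of k + frag_of (- k)"] that] by (simp add: add.commute)
  have flip: "frag_of (1 - k) \<in> S" if "frag_of k \<in> S" for k
    using diff[OF sym1[of "frag_of k + frag_of (1 - k)"] that] by (simp add: add.commute)
  have single: "frag_of k \<in> S" for k
  \<comment> \<open>\<open>neg\<close> then \<open>flip\<close> moves the point up by one;
    \<open>flip\<close> then \<open>neg\<close> moves it down by one.\<close>
  proof (induction k rule: int_induct[where k = 0])
    case base
    show ?case by (rule sym0) simp
  next
    case (step1 i)
    then show ?case using flip[OF neg[of i]] by (simp add: add.commute)
  next
    case (step2 i)
    then show ?case using neg[OF flip[of i]] by simp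
  qed
  have "f \<in> S"
    using subset_UNIV[of "Poly_Mapping.keys f"]
    by (induction f rule: frag_induction) (auto intro: single diff sym0)
  then show ?thesis unfolding S_def by blast
qed

lemma product_of_three_palindromes:
  "\<exists>ps. length ps \<le> 3 \<and> set ps \<subseteq> palindromes ZwrZ {wr_a, wr_t} \<and> x = word_value ps"
proof -
  obtain f m where x: "x = (f, m)" by fastforce
  obtain g h where "f = g + h" "reflect 0 g = g" "reflect 1 h = h"
    using symmetric_decomposition by blast
  then show ?thesis
    \<comment> \<open>The exponent \<open>0\<close> of the first factor leaves \<open>h\<close>
      unshifted; the last factor is a power of \<open>t\<close>, which only corrects the
      exponent.\<close>
    by (intro exI[of _ "[(g, 0), (h, 1), (0, m - 1)]"]) (simp add: x in_palindromes_iff)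
qed

lemma product_of_two_palindromes_symmetric:
  assumes "length ps \<le> 2" "set ps \<subseteq> palindromes ZwrZ {wr_a, wr_t}" "word_value ps = (f, 0)"
  shows "\<exists>m. reflect m f = f"
proof -
  consider "ps = []" | p where "ps = [p]" | p q where "ps = [p, q]"
    using assms(1) by (cases ps; cases "tl ps"; auto)
  then show ?thesis
  proof cases
    case 1
    then show ?thesis using assms(3) by auto
  next
    case 2
    then show ?thesis using assms(2,3) by (cases p) (auto simp: in_palindromes_iff)
  next
    case 3
    obtain g m h n where "p = (g, m)" "q = (h, n)" by fastforce
    then have "f = g + shift m h" "n = - m" "reflect m g = g" "reflect n h = h"
      using 3 assms(2,3) by (auto simp: in_palindromes_iff)
    \<comment> \<open>Since \<open>n = - m\<close>, both sides equal
      \<open>reflect 0 h\<close>.\<close>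
    moreover from this have "shift m h = reflect m (shift m h)"
      using reflect_simps(5)[of m n h] by simp
    ultimately show ?thesis
      by (intro exI[of _ m]) (metis reflect_simps(2))
  qed
qed

lemma asymmetric_example:
  "reflect m (Poly_Mapping.single 0 1 + Poly_Mapping.single 1 2)
     \<noteq> Poly_Mapping.single 0 1 + Poly_Mapping.single 1 2" (is "reflect m ?f \<noteq> ?f")
proof
  assume "reflect m ?f = ?f"
  then have "Poly_Mapping.lookup ?f (m - i) = Poly_Mapping.lookup ?f i" for i
    by (metis lookup_reflect)
  \<comment> \<open>The value \<open>1\<close> occurs only at \<open>0\<close>, forcing
    \<open>m = 0\<close>; the value \<open>2\<close> occurs only at \<open>1\<close>, forcing
    \<open>m = 2\<close>.\<close>
  from this[of 0] this[of 1] show False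
    by (auto simp: lookup_add lookup_single lookup_one when_def split: if_splits)
qed

theorem theorem1p2:
  shows "palindromic_width ZwrZ {wr_a, wr_t} = 3"
proof (rule antisym)
  show "palindromic_width ZwrZ {wr_a, wr_t} \<le> 3"
    unfolding palindromic_width_def
    by (rule Inf_lower)
      (use product_of_three_palindromes in \<open>auto intro!: exI[of _ 3] simp: numeral_eq_enat\<close>)
next
  show "3 \<le> palindromic_width ZwrZ {wr_a, wr_t}"
    unfolding palindromic_width_def
  proof (rule Inf_greatest, clarify)
    fix n
    assume n: "\<forall>h \<in> carrier ZwrZ. \<exists>ps. length ps \<le> n \<and> set ps \<subseteq> palindromes ZwrZ {wr_a, wr_t} \<and>
      h = word_value ps"
    have "\<not> n \<le> 2"
    proof
      assume "n \<le> 2"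
      obtain ps where "length ps \<le> n" "set ps \<subseteq> palindromes ZwrZ {wr_a, wr_t}"
        "(Poly_Mapping.single 0 1 + Poly_Mapping.single 1 2, 0) = word_value ps"
        using n by (metis UNIV_I ZwrZ_simps(1))
      with \<open>n \<le> 2\<close> show False
        using product_of_two_palindromes_symmetric[OF _ _ sym] asymmetric_example
        by (meson le_trans)
    qed
    then show "3 \<le> enat n"
      by (simp add: numeral_eq_enat)
  qed
qed

end
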